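(* For every preference relation $\succsim$ on $\mathcal X$ satisfying Axioms (RC), (M), (SRM) and (C), there exists a unique $\succsim$-matching probability $\nu$. Furthermore, $\nu$ is a continuous risk-conforming capacity, and $$A\succsim B\iff\nu(A)\ge\nu(B),\qquad A,B\in\mathcal F.$$
   Context: Setting. $(\Omega,\mathcal F)$ is a measurable space, $\mathcal G\subseteq\mathcal F$ is a sub-$\sigma$-algebra, and $\mathbb P:\mathcal G\to[0,1]$ is a (countably additive) probability measure that is atomless: $\{\mathbb P(B):B\in\mathcal G,\,B\subseteq A\}=[0,\mathbb P(A)]$ for every $A\in\mathcal G$. An act is a bounded $\mathcal F$-measurable function $X:\Omega\to\mathbb R$; $\mathcal X$ is the set of acts, $\mathcal X(\mathcal G)$ the set of $\mathcal G$-measurable acts. A preference relation $\succsim$ is a total preorder on $\mathcal X$; $\succ$ and $\simeq$ are its strict and symmetric parts. For $A,B\in\mathcal F$, $A\succsim B$ means $\mathbf 1_A\succsim\mathbf 1_B$ (similarly $\simeq$). A capacity is $\nu:\mathcal F\to\mathbb R$ with $\nu(\varnothing)=0$, $\nu(\Omega)=1$, and $\nu(A)\le\nu(B)$ whenever $A\subseteq B$. It is continuous if $\nu(A_n)\to\nu(\bigcup_n A_n)$ for increasing sequences and $\nu(A_n)\to\nu(\bigcap_n A_n)$ for decreasing sequences in $\mathcal F$. It is risk conforming if $\nu|_{\mathcal G}=\mathbb P$. Axioms. (RC) If $X,Y\in\mathcal X(\mathcal G)$ and $\mathbb P(X>x)=\mathbb P(Y>x)$ for all $x\in\mathbb R$,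 then $X\simeq Y$. (M) If $X,Y\in\mathcal X$ and $X(\omega)\ge Y(\omega)$ for all $\omega$, then $X\succsim Y$. (SRM) If $X,Y\in\mathcal X(\mathcal G)$, $\mathbb P(X\ge Y)=1$ and $\mathbb P(X>Y)>0$, then $X\succ Y$. (C) For all $X\in\mathcal X$, the sets $\{Y\in\mathcal X:X\succsim Y\}$ and $\{Y\in\mathcal X:Y\succsim X\}$ are B-closed, where $\mathcal S\subseteq\mathcal X$ is B-closed if whenever $(X_n)_{n\in\mathbb N}\subseteq\mathcal S$ satisfies $\sup_n\sup_\omega|X_n(\omega)|<\infty$ and $X_n\to X\in\mathcal X$ pointwise, then $X\in\mathcal S$. A $\succsim$-matching probability is a function $\nu:\mathcal F\to[0,1]$ such that for every $A\in\mathcal F$ there is $R_A\in\mathcal G$ with $\nu(A)=\mathbb P(R_A)$ and $A\simeq R_A$. *)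

theory Defs
  imports "HOL-Probability.Probability"
begin

text \<open>
  The measurable space \<open>(\<Omega>, \<F>)\<close> is a value \<open>F :: 'a measure\<close>, of which only
  \<open>space F\<close> and \<open>sets F\<close> are used. The triple \<open>(\<Omega>, \<G>, \<P>)\<close> is a second value \<open>P\<close>, a
  probability space with \<open>subalgebra F P\<close>. Functions on \<open>\<Omega>\<close> and on \<open>\<F>\<close> are represented
  extensionally, i.e. they are \<open>undefined\<close> outside their domain, so that HOL equality
  is equality of functions on \<open>\<Omega>\<close> (resp. \<open>\<F>\<close>).
\<close>

definition atomless :: "'a measure \<Rightarrow> bool" where
  "atomless P \<longleftrightarrow>
    (\<forall>A\<in>sets P. {measure P B |B. B \<in> sets P \<and> B \<subseteq> A} = {0..measure P A})"

text \<open>For the sub-\<open>\<sigma>\<close>-algebra, \<open>acts P\<close> is the set of \<open>\<G>\<close>-measurable acts.\<close>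

definition acts :: "'a measure \<Rightarrow> ('a \<Rightarrow> real) set" where
  "acts M = {X \<in> extensional (space M). X \<in> borel_measurable M \<and> bounded (X ` space M)}"

definition indicator_act :: "'a measure \<Rightarrow> 'a set \<Rightarrow> 'a \<Rightarrow> real" where
  "indicator_act M A = (\<lambda>\<omega>\<in>space M. indicator A \<omega>)"

text \<open>A preference relation is the set \<open>R\<close> of pairs \<open>(X, Y)\<close> such that \<open>X\<close> is weakly preferred
  to \<open>Y\<close>.\<close>

definition preference_relation :: "'a measure \<Rightarrow> ('a \<Rightarrow> real) rel \<Rightarrow> bool" where
  "preference_relation F R \<longleftrightarrow> preorder_on (acts F) R \<and> total_on (acts F) R"

definition strictly_preferred :: "'b rel \<Rightarrow> 'b \<Rightarrow> 'b \<Rightarrow> bool" where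
  "strictly_preferred R X Y \<longleftrightarrow> (X, Y) \<in> R \<and> (Y, X) \<notin> R"

definition indifferent :: "'b rel \<Rightarrow> 'b \<Rightarrow> 'b \<Rightarrow> bool" where
  "indifferent R X Y \<longleftrightarrow> (X, Y) \<in> R \<and> (Y, X) \<in> R"

definition event_preferred ::
    "'a measure \<Rightarrow> ('a \<Rightarrow> real) rel \<Rightarrow> 'a set \<Rightarrow> 'a set \<Rightarrow> bool" where
  "event_preferred F R A B \<longleftrightarrow> (indicator_act F A, indicator_act F B) \<in> R"

definition event_indifferent ::
    "'a measure \<Rightarrow> ('a \<Rightarrow> real) rel \<Rightarrow> 'a set \<Rightarrow> 'a set \<Rightarrow> bool" where
  "event_indifferent F R A B \<longleftrightarrow> indifferent R (indicator_act F A) (indicator_act F B)"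

definition axiom_RC :: "'a measure \<Rightarrow> ('a \<Rightarrow> real) rel \<Rightarrow> bool" where
  "axiom_RC P R \<longleftrightarrow>
    (\<forall>X\<in>acts P. \<forall>Y\<in>acts P.
      (\<forall>x. measure P {\<omega>\<in>space P. X \<omega> > x} = measure P {\<omega>\<in>space P. Y \<omega> > x}) \<longrightarrow>
      indifferent R X Y)"

definition axiom_M :: "'a measure \<Rightarrow> ('a \<Rightarrow> real) rel \<Rightarrow> bool" where
  "axiom_M F R \<longleftrightarrow>
    (\<forall>X\<in>acts F. \<forall>Y\<in>acts F. (\<forall>\<omega>\<in>space F. X \<omega> \<ge> Y \<omega>) \<longrightarrow> (X, Y) \<in> R)"

definition axiom_SRM :: "'a measure \<Rightarrow> ('a \<Rightarrow> real) rel \<Rightarrow> bool" where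
  "axiom_SRM P R \<longleftrightarrow>
    (\<forall>X\<in>acts P. \<forall>Y\<in>acts P.
      measure P {\<omega>\<in>space P. X \<omega> \<ge> Y \<omega>} = 1 \<and> measure P {\<omega>\<in>space P. X \<omega> > Y \<omega>} > 0 \<longrightarrow>
      strictly_preferred R X Y)"

definition B_closed :: "'a measure \<Rightarrow> ('a \<Rightarrow> real) set \<Rightarrow> bool" where
  "B_closed F S \<longleftrightarrow> S \<subseteq> acts F \<and>
    (\<forall>X Y. (\<forall>n::nat. X n \<in> S) \<and> (\<exists>K. \<forall>n. \<forall>\<omega>\<in>space F. \<bar>X n \<omega>\<bar> \<le> K) \<and>
      Y \<in> acts F \<and> (\<forall>\<omega>\<in>space F. (\<lambda>n. X n \<omega>) \<longlonglongrightarrow> Y \<omega>) \<longrightarrow> Y \<in> S)"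

definition axiom_C :: "'a measure \<Rightarrow> ('a \<Rightarrow> real) rel \<Rightarrow> bool" where
  "axiom_C F R \<longleftrightarrow>
    (\<forall>X\<in>acts F. B_closed F {Y\<in>acts F. (X, Y) \<in> R} \<and> B_closed F {Y\<in>acts F. (Y, X) \<in> R})"

definition matching_probability ::
    "'a measure \<Rightarrow> 'a measure \<Rightarrow> ('a \<Rightarrow> real) rel \<Rightarrow> ('a set \<Rightarrow> real) \<Rightarrow> bool" where
  "matching_probability F P R \<nu> \<longleftrightarrow> \<nu> \<in> sets F \<rightarrow>\<^sub>E {0..1} \<and>
    (\<forall>A\<in>sets F. \<exists>R\<^sub>A\<in>sets P. \<nu> A = measure P R\<^sub>A \<and> event_indifferent F R A R\<^sub>A)"

definition capacity :: "'a measure \<Rightarrow> ('a set \<Rightarrow> real) \<Rightarrow> bool" where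
  "capacity F \<nu> \<longleftrightarrow> \<nu> \<in> extensional (sets F) \<and> \<nu> {} = 0 \<and> \<nu> (space F) = 1 \<and>
    (\<forall>A\<in>sets F. \<forall>B\<in>sets F. A \<subseteq> B \<longrightarrow> \<nu> A \<le> \<nu> B)"

definition continuous_capacity :: "'a measure \<Rightarrow> ('a set \<Rightarrow> real) \<Rightarrow> bool" where
  "continuous_capacity F \<nu> \<longleftrightarrow> capacity F \<nu> \<and>
    (\<forall>A. range A \<subseteq> sets F \<and> incseq A \<longrightarrow> (\<lambda>n. \<nu> (A n)) \<longlonglongrightarrow> \<nu> (\<Union>n. A n)) \<and>
    (\<forall>A. range A \<subseteq> sets F \<and> decseq A \<longrightarrow> (\<lambda>n. \<nu> (A n)) \<longlonglongrightarrow> \<nu> (\<Inter>n. A n))"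

definition risk_conforming :: "'a measure \<Rightarrow> ('a set \<Rightarrow> real) \<Rightarrow> bool" where
  "risk_conforming P \<nu> \<longleftrightarrow> (\<forall>A\<in>sets P. \<nu> A = measure P A)"

end

theory Submission
  imports Defs
begin

text \<open>
  By atomlessness any two events of \<open>\<G>\<close> can be compared through nested events of the same
  probabilities, so (RC), (M) and (SRM) make the preference on \<open>\<G>\<close> agree with \<open>\<P>\<close>. For an
  arbitrary event \<open>A\<close> let \<open>s\<close> be the supremum of the probabilities of the events of \<open>\<G>\<close> that \<open>A\<close>
  is preferred to. Approximating an event of probability \<open>s\<close> by monotone sequences in \<open>\<G>\<close> of
  strictly smaller, respectively strictly larger, probability, (C) shows that \<open>A\<close> is indifferent
  to every event of \<open>\<G>\<close> of probability \<open>s\<close>.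
\<close>

section \<open>Events of prescribed probability in an atomless space\<close>

lemma atomless_subset:
  assumes "atomless P" "A \<in> sets P" "0 \<le> t" "t \<le> measure P A"
  obtains B where "B \<in> sets P" "B \<subseteq> A" "measure P B = t"
proof -
  have "{measure P B |B. B \<in> sets P \<and> B \<subseteq> A} = {0..measure P A}"
    using assms(1,2) unfolding atomless_def by blast
  then have "t \<in> {measure P B |B. B \<in> sets P \<and> B \<subseteq> A}" using assms(3,4) by simp
  then show thesis using that by blast
qed

text \<open>The events are built by recursion. The complement of the current event has mass
  \<open>1 - t n\<close>, and \<open>t (Suc n)\<close> is at most 1, so a piece of mass
  \<open>t (Suc n) - t n\<close> can be cut out of it and adjoined.\<close>

lemma (in prob_space) atomless_incseq:
  assumes atomless: "atomless M" and t: "incseq t" "range t \<subseteq> {0..1}"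
  obtains B where "range B \<subseteq> sets M" "incseq B" "\<And>n::nat. prob (B n) = t n"
proof -
  have t01: "0 \<le> t n" "t n \<le> 1" for n using t(2) by (auto simp: subset_iff)
  have "\<exists>B. \<forall>n. (B n \<in> events \<and> prob (B n) = t n) \<and> B n \<subseteq> B (Suc n)"
  proof (rule dependent_nat_choice)
    obtain B where "B \<in> events" "prob B = t 0"
      using atomless_subset[OF atomless sets.top t01(1)[of 0]] t01(2)[of 0] by (auto simp: prob_space)
    then show "\<exists>B. B \<in> events \<and> prob B = t 0" by blast
  next
    fix A n assume A: "A \<in> events \<and> prob A = t n"
    have "0 \<le> t (Suc n) - t n" using t(1) by (simp add: incseq_SucD)
    moreover have "t (Suc n) - t n \<le> prob (space M - A)"
      using A t01(2)[of "Suc n"] by (simp add: prob_compl)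
    ultimately obtain D where D: "D \<in> events" "D \<subseteq> space M - A" "prob D = t (Suc n) - t n"
      using A atomless_subset[OF atomless, of "space M - A" "t (Suc n) - t n"] by blast
    have "prob (A \<union> D) = prob A + prob D"
      using A D by (intro finite_measure_Union) auto
    then have "A \<union> D \<in> events \<and> prob (A \<union> D) = t (Suc n)" using A D by auto
    then show "\<exists>B. (B \<in> events \<and> prob B = t (Suc n)) \<and> A \<subseteq> B" by blast
  qed
  then obtain B where "\<And>n. B n \<in> events" "\<And>n. prob (B n) = t n" "\<And>n. B n \<subseteq> B (Suc n)"
    by blast
  then show thesis by (intro that[of B] incseq_SucI) auto
qed

text \<open>The strict inequality is what matters: events of probability below a supremum can be
  compared directly, while the value \<open>s\<close> is reached only in the limit, where (C) takes
  over.\<close>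

lemma (in prob_space) atomless_approx_below:
  assumes atomless: "atomless M" and s: "0 < s" "s \<le> 1"
  obtains B where "range B \<subseteq> sets M" "incseq B" "\<And>n::nat. prob (B n) < s"
    "prob (\<Union>n. B n) = s"
proof -
  \<comment> \<open>These values start at 0 and increase to \<open>s\<close>; they stay below
    \<open>s\<close> because \<open>s\<close> is positive.\<close>
  define t where "t n = s * (1 - inverse (real (Suc n)))" for n
  have "incseq t"
    unfolding t_def using s by (intro incseq_SucI mult_left_mono) (auto simp: field_simps)
  moreover have "t n \<in> {0..1}" for n
    unfolding t_def using s
    by (auto intro!: mult_nonneg_nonneg mult_le_one simp: inverse_eq_divide)
  then have "range t \<subseteq> {0..1}" by blast
  ultimately obtain B where B: "range B \<subseteq> sets M" "incseq B" "\<And>n::nat. prob (B n) = t n"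
    using atomless_incseq[OF atomless] by blast
  have "t \<longlonglongrightarrow> s * (1 - 0)"
    unfolding t_def by (intro tendsto_intros LIMSEQ_inverse_real_of_nat)
  moreover have "t \<longlonglongrightarrow> prob (\<Union>n. B n)"
    using finite_Lim_measure_incseq[OF B(1,2)] B(3) by simp
  ultimately have "prob (\<Union>n. B n) = s" using LIMSEQ_unique by fastforce
  moreover have "prob (B n) < s" for n unfolding B(3) t_def using s by simp
  ultimately show thesis using that B by blast
qed

text \<open>Complements of an approximation of \<open>1 - s\<close> from below.\<close>

lemma (in prob_space) atomless_approx_above:
  assumes atomless: "atomless M" and s: "0 \<le> s" "s < 1"
  obtains B where "range B \<subseteq> sets M" "decseq B" "\<And>n::nat. s < prob (B n)"
    "prob (\<Inter>n. B n) = s"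
proof -
  obtain C where C: "range C \<subseteq> sets M" "incseq C" "\<And>n::nat. prob (C n) < 1 - s"
    "prob (\<Union>n. C n) = 1 - s"
    using atomless_approx_below[OF atomless, of "1 - s"] s by auto
  have CM: "C n \<in> events" for n using C(1) by auto
  let ?B = "\<lambda>n. space M - C n"
  have "range ?B \<subseteq> events" using CM by auto
  moreover have "decseq ?B" using C(2) unfolding incseq_def decseq_def by blast
  moreover have "s < prob (?B n)" for n using C(3)[of n] prob_compl[OF CM[of n]] by simp
  moreover have "(\<Inter>n. ?B n) = space M - (\<Union>n. C n)" by auto
  then have "prob (\<Inter>n. ?B n) = s"
    using C(4) prob_compl[of "\<Union>n. C n"] CM by (simp add: sets.countable_UN)
  ultimately show thesis by (rule that)
qed

section \<open>Indicator acts and bounded pointwise limits\<close>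

lemma indicator_act_acts:
  assumes "A \<in> sets M"
  shows "indicator_act M A \<in> acts M"
proof -
  have "indicator_act M A \<in> borel_measurable M"
    using borel_measurable_indicator[OF assms]
    by (subst measurable_cong[of _ _ "indicator A"]) (auto simp: indicator_act_def)
  moreover have "bounded (indicator_act M A ` space M)"
    by (auto intro!: boundedI[of _ 1] simp: indicator_act_def indicator_def)
  ultimately show ?thesis by (simp add: acts_def indicator_act_def)
qed

lemma B_closedD:
  assumes "B_closed F S" "\<And>n::nat. X n \<in> S" "\<And>n \<omega>. \<omega> \<in> space F \<Longrightarrow> \<bar>X n \<omega>\<bar> \<le> K"
    and "Y \<in> acts F" "\<And>\<omega>. \<omega> \<in> space F \<Longrightarrow> (\<lambda>n. X n \<omega>) \<longlonglongrightarrow> Y \<omega>"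
  shows "Y \<in> S"
proof -
  have "(\<forall>n::nat. X n \<in> S) \<and> (\<exists>K. \<forall>n. \<forall>\<omega>\<in>space F. \<bar>X n \<omega>\<bar> \<le> K) \<and>
      Y \<in> acts F \<and> (\<forall>\<omega>\<in>space F. (\<lambda>n. X n \<omega>) \<longlonglongrightarrow> Y \<omega>) \<longrightarrow> Y \<in> S"
    using assms(1) unfolding B_closed_def by (elim conjE allE)
  then show ?thesis using assms(2-5) by blast
qed

section \<open>Comparison of events under the axioms\<close>

locale regular_preference = prob_space P for P :: "'a measure" +
  fixes F :: "'a measure" and R :: "('a \<Rightarrow> real) rel"
  assumes subalgebra: "subalgebra F P" and atomless: "atomless P"
    and preference: "preference_relation F R"
    and RC: "axiom_RC P R" and M: "axiom_M F R" and SRM: "axiom_SRM P R" and C: "axiom_C F R"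
begin

abbreviation event_pref (infix "\<succeq>" 50) where
  "A \<succeq> B \<equiv> event_preferred F R A B"

lemma space_P [simp]: "space P = space F"
  using subalgebra by (simp add: subalgebra_def)

lemma sets_P_F: "A \<in> sets P \<Longrightarrow> A \<in> sets F"
  using subalgebra by (auto simp: subalgebra_def)

lemma indicator_act_F: "A \<in> sets F \<Longrightarrow> indicator_act F A \<in> acts F"
  by (rule indicator_act_acts)

text \<open>\<open>F\<close> and \<open>P\<close> have the same space, so the extensional indicator
  taken over \<open>F\<close> is the very function taken over \<open>P\<close>.\<close>

lemma indicator_act_P: "A \<in> sets P \<Longrightarrow> indicator_act F A \<in> acts P"
  using indicator_act_acts[of A P] by (simp add: indicator_act_def)

lemma event_pref_trans: "A \<succeq> B \<Longrightarrow> B \<succeq> D \<Longrightarrow> A \<succeq> D"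
  using preference unfolding event_preferred_def preference_relation_def preorder_on_def
  by (blast dest: transD)

lemma event_pref_total: "A \<in> sets F \<Longrightarrow> B \<in> sets F \<Longrightarrow> A \<succeq> B \<or> B \<succeq> A"
  using preference indicator_act_F
  unfolding event_preferred_def preference_relation_def preorder_on_def total_on_def refl_on_def
  by metis

lemma event_pref_mono:
  assumes "A \<in> sets F" "B \<in> sets F" "B \<subseteq> A"
  shows "A \<succeq> B"
proof -
  have "\<forall>\<omega>\<in>space F. indicator_act F A \<omega> \<ge> indicator_act F B \<omega>"
    using assms(3) by (auto simp: indicator_act_def indicator_def)
  then show ?thesis
    using M indicator_act_F assms(1,2) unfolding axiom_M_def event_preferred_def by blast
qed

lemma event_indifferent_iff: "event_indifferent F R A B \<longleftrightarrow> A \<succeq> B \<and> B \<succeq> A"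
  by (simp add: event_indifferent_def indifferent_def event_preferred_def)

lemma event_pref_prob_eq:
  assumes "A \<in> sets P" "B \<in> sets P" "prob A = prob B"
  shows "A \<succeq> B"
proof -
  \<comment> \<open>The upper level sets of an indicator are the whole space, the event or the empty
    set, so its distribution depends only on the probability of the event and (RC) applies.\<close>
  have "{\<omega>\<in>space P. indicator_act F D \<omega> > x} =
      (if x < 0 then space P else if x < 1 then D else {})" if "D \<in> sets P" for D x
    using sets.sets_into_space[OF that] by (auto simp: indicator_act_def indicator_def)
  then have "\<forall>x. prob {\<omega>\<in>space P. indicator_act F A \<omega> > x} =
      prob {\<omega>\<in>space P. indicator_act F B \<omega> > x}"
    using assms by simp
  then show ?thesis
    using RC indicator_act_P assms(1,2)
    unfolding axiom_RC_def indifferent_def event_preferred_def by blast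
qed

text \<open>The larger indicator dominates everywhere and exceeds the smaller one exactly on
  \<open>A - B\<close>, which has positive probability; this is the situation of (SRM).\<close>

lemma event_pref_subset_strict:
  assumes "A \<in> sets P" "B \<in> sets P" "B \<subseteq> A" "prob B < prob A"
  shows "\<not> B \<succeq> A"
proof -
  have ge: "{\<omega>\<in>space P. indicator_act F A \<omega> \<ge> indicator_act F B \<omega>} = space P"
    using assms by (auto simp: indicator_act_def indicator_def)
  have gt: "{\<omega>\<in>space P. indicator_act F A \<omega> > indicator_act F B \<omega>} = A - B"
    using assms(3) sets.sets_into_space[OF assms(1)]
    by (auto simp: indicator_act_def indicator_def split: if_splits)
  have pos: "prob (A - B) > 0"
    using assms by (simp add: finite_measure_Diff)
  have "strictly_preferred R (indicator_act F A) (indicator_act F B)"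
    using SRM[unfolded axiom_SRM_def, THEN bspec, OF indicator_act_P[OF assms(1)],
        THEN bspec, OF indicator_act_P[OF assms(2)]]
    unfolding ge gt using pos prob_space by blast
  then show ?thesis by (simp add: strictly_preferred_def event_preferred_def)
qed

lemma event_pref_iff_prob:
  assumes "A \<in> sets P" "B \<in> sets P"
  shows "A \<succeq> B \<longleftrightarrow> prob B \<le> prob A"
proof
  assume "prob B \<le> prob A"
  \<comment> \<open>A copy of \<open>B\<close> inside \<open>A\<close>: (M) compares
    \<open>A\<close> with the copy, and (RC) the copy with \<open>B\<close>.\<close>
  then obtain D where D: "D \<in> sets P" "D \<subseteq> A" "prob D = prob B"
    using atomless_subset[OF atomless assms(1)] by (metis measure_nonneg)
  then have "A \<succeq> D" "D \<succeq> B"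
    using event_pref_mono event_pref_prob_eq sets_P_F assms by auto
  then show "A \<succeq> B" by (rule event_pref_trans)
next
  assume AB: "A \<succeq> B"
  show "prob B \<le> prob A"
  proof (rule ccontr)
    assume less: "\<not> prob B \<le> prob A"
    \<comment> \<open>A copy of \<open>A\<close> inside \<open>B\<close> would be preferred to
      \<open>B\<close> although it is a subset of smaller probability.\<close>
    then obtain D where D: "D \<in> sets P" "D \<subseteq> B" "prob D = prob A"
      using atomless_subset[OF atomless assms(2)] by (metis measure_nonneg nle_le)
    then have "D \<succeq> B" using event_pref_prob_eq assms AB event_pref_trans by metis
    then show False using event_pref_subset_strict[of B D] D less assms by simp
  qed
qed

text \<open>Indicators are bounded by 1, so their pointwise convergence is of the kind under which
  the sets in (C) are closed.\<close>

lemma event_pref_limit: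
  assumes "\<And>n::nat. A n \<in> sets F" "A' \<in> sets F" "B \<in> sets F"
    and "\<And>\<omega>. (\<lambda>n. indicator (A n) \<omega> :: real) \<longlonglongrightarrow> indicator A' \<omega>"
  shows "(\<And>n. A n \<succeq> B) \<Longrightarrow> A' \<succeq> B" and "(\<And>n. B \<succeq> A n) \<Longrightarrow> B \<succeq> A'"
proof -
  let ?X = "\<lambda>n. indicator_act F (A n)"
  have closed: "indicator_act F A' \<in> S" if S: "B_closed F S" "\<And>n. ?X n \<in> S" for S
  proof (rule B_closedD[OF S(1)])
    show "?X n \<in> S" for n by (rule S(2))
    show "\<bar>?X n \<omega>\<bar> \<le> 1" if "\<omega> \<in> space F" for n \<omega>
      using that by (simp add: indicator_act_def indicator_def)
    show "indicator_act F A' \<in> acts F" by (rule indicator_act_F[OF assms(2)])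
    show "(\<lambda>n. ?X n \<omega>) \<longlonglongrightarrow> indicator_act F A' \<omega>" if "\<omega> \<in> space F" for \<omega>
      using assms(4)[of \<omega>] that by (simp add: indicator_act_def)
  qed
  have C': "B_closed F {Y\<in>acts F. (indicator_act F B, Y) \<in> R}"
      "B_closed F {Y\<in>acts F. (Y, indicator_act F B) \<in> R}"
    using C[unfolded axiom_C_def, THEN bspec, OF indicator_act_F[OF assms(3)]] by blast+
  show "A' \<succeq> B" if "\<And>n. A n \<succeq> B"
    using closed[OF C'(2)] that indicator_act_F[OF assms(1)] by (simp add: event_preferred_def)
  show "B \<succeq> A'" if "\<And>n. B \<succeq> A n"
    using closed[OF C'(1)] that indicator_act_F[OF assms(1)] by (simp add: event_preferred_def)
qed

lemma event_pref_incseq: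
  assumes A: "range A \<subseteq> sets F" "incseq A" and "B \<in> sets F" "\<And>n::nat. B \<succeq> A n"
  shows "B \<succeq> (\<Union>n. A n)"
  by (rule event_pref_limit(2)[OF _ _ assms(3) LIMSEQ_indicator_incseq[OF A(2)] assms(4)])
    (use A(1) in auto)

lemma event_pref_decseq:
  assumes A: "range A \<subseteq> sets F" "decseq A" and "B \<in> sets F" "\<And>n::nat. A n \<succeq> B"
  shows "(\<Inter>n. A n) \<succeq> B"
  by (rule event_pref_limit(1)[OF _ _ assms(3) LIMSEQ_indicator_decseq[OF A(2)] assms(4)])
    (use A(1) in auto)

section \<open>Existence and uniqueness of the matching probability\<close>

lemma matching_event:
  assumes A: "A \<in> sets F"
  obtains B where "B \<in> sets P" "event_indifferent F R A B"
proof -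
  define S where "S = prob ` {B \<in> sets P. A \<succeq> B}"
  define s where "s = Sup S"
  have empty: "A \<succeq> {}" using event_pref_mono[OF A] by simp
  have S0: "0 \<in> S" unfolding S_def using empty by (auto intro!: image_eqI[of _ _ "{}"])
  have S_le: "t \<le> 1" if "t \<in> S" for t using that by (auto simp: S_def)
  have bdd: "bdd_above S" using S_le by (rule bdd_aboveI)
  have s: "0 \<le> s" "s \<le> 1"
    unfolding s_def using cSup_upper[OF S0 bdd] cSup_least[of S 1] S0 S_le by auto
  \<comment> \<open>By the definition of the supremum, \<open>A\<close> is preferred to some event
    of larger probability than \<open>B\<close>.\<close>
  have below: "A \<succeq> B" if B: "B \<in> sets P" "prob B < s" for B
  proof -
    obtain D where "D \<in> sets P" "A \<succeq> D" "prob B < prob D"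
      using B(2) less_cSup_iff[of S "prob B"] S0 bdd unfolding s_def S_def by auto
    then show ?thesis using event_pref_trans event_pref_iff_prob[of D B] B by force
  qed
  \<comment> \<open>Otherwise totality would put \<open>prob B\<close> into \<open>S\<close>, beyond
    its supremum.\<close>
  have above: "B \<succeq> A" if B: "B \<in> sets P" "s < prob B" for B
  proof (rule ccontr)
    assume "\<not> B \<succeq> A"
    then have "prob B \<in> S" unfolding S_def using event_pref_total[OF A] B sets_P_F by blast
    then show False using B(2) cSup_upper[OF _ bdd] unfolding s_def by force
  qed
  obtain B where B: "B \<in> sets P" "prob B = s" "A \<succeq> B"
  \<comment> \<open>No event has probability strictly below 0, so the approximation is replaced by
    the empty set.\<close>
  proof (cases "s = 0")
    case True
    then show thesis using that[of "{}"] empty by simp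
  next
    case False
    then obtain B where B: "range B \<subseteq> sets P" "incseq B" "\<And>n::nat. prob (B n) < s"
        "prob (\<Union>n. B n) = s"
      using atomless_approx_below[OF atomless] s by (metis less_eq_real_def)
    then have "A \<succeq> (\<Union>n. B n)"
      using A below sets_P_F by (intro event_pref_incseq) auto
    then show thesis using B by (intro that[of "\<Union>n. B n"]) auto
  qed
  obtain D where D: "D \<in> sets P" "prob D = s" "D \<succeq> A"
  \<comment> \<open>Likewise no event has probability above 1, and the whole space serves
    directly.\<close>
  proof (cases "s = 1")
    case True
    have "space P \<succeq> A"
      using event_pref_mono[OF sets.top A] sets.sets_into_space[OF A] by simp
    then show thesis using that[of "space P"] True prob_space by blast
  next
    case False
    then obtain B where B: "range B \<subseteq> sets P" "decseq B" "\<And>n::nat. s < prob (B n)"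
        "prob (\<Inter>n. B n) = s"
      using atomless_approx_above[OF atomless] s by (metis less_eq_real_def)
    then have "(\<Inter>n. B n) \<succeq> A"
      using A above sets_P_F by (intro event_pref_decseq) auto
    then show thesis using B by (intro that[of "\<Inter>n. B n"]) auto
  qed
  \<comment> \<open>\<open>B\<close> and \<open>D\<close> come from different approximations but
    share the probability \<open>s\<close>, so (RC) links them.\<close>
  have "B \<succeq> A" using event_pref_trans[OF event_pref_prob_eq D(3)] B D by simp
  then show thesis using that B by (auto simp: event_indifferent_iff)
qed

lemma matching_event_prob_unique:
  assumes "B \<in> sets P" "D \<in> sets P" "event_indifferent F R A B" "event_indifferent F R A D"
  shows "prob B = prob D"
  using assms event_pref_trans event_pref_iff_prob unfolding event_indifferent_iff
  by (meson order_antisym)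

lemma matching_probability_ex1: "\<exists>!\<nu>. matching_probability F P R \<nu>"
proof (rule ex_ex1I)
  have "\<forall>A\<in>sets F. \<exists>B. B \<in> sets P \<and> event_indifferent F R A B"
    using matching_event by blast
  then obtain E where "\<forall>A\<in>sets F. E A \<in> sets P \<and> event_indifferent F R A (E A)"
    using bchoice by metis
  then have "matching_probability F P R (\<lambda>A\<in>sets F. prob (E A))"
    unfolding matching_probability_def by auto
  then show "\<exists>\<nu>. matching_probability F P R \<nu>" by blast
next
  fix \<nu> \<mu> assume \<nu>: "matching_probability F P R \<nu>" and \<mu>: "matching_probability F P R \<mu>"
  show "\<nu> = \<mu>"
  \<comment> \<open>Both functions are \<open>undefined\<close> off \<open>sets F\<close>, so
    agreement on \<open>sets F\<close> yields equality.\<close>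
  proof (rule PiE_ext)
    show "\<nu> \<in> sets F \<rightarrow>\<^sub>E {0..1}" "\<mu> \<in> sets F \<rightarrow>\<^sub>E {0..1}"
      using \<nu> \<mu> by (auto simp: matching_probability_def)
    show "\<nu> A = \<mu> A" if "A \<in> sets F" for A
      using \<nu> \<mu> that matching_event_prob_unique unfolding matching_probability_def by metis
  qed
qed

section \<open>Representation, risk conformity and continuity\<close>

context
  fixes \<nu>
  assumes \<nu>: "matching_probability F P R \<nu>"
begin

lemma matching_event_exists:
  assumes "A \<in> sets F"
  obtains B where "B \<in> sets P" "\<nu> A = prob B" "A \<succeq> B" "B \<succeq> A"
  using \<nu> assms unfolding matching_probability_def event_indifferent_iff by blast

text \<open>Each event can be exchanged for its match in \<G>, where probability decides the
  comparison.\<close>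

lemma event_pref_iff_matching:
  assumes "A \<in> sets F" "B \<in> sets F"
  shows "A \<succeq> B \<longleftrightarrow> \<nu> B \<le> \<nu> A"
proof -
  obtain A' where A': "A' \<in> sets P" "\<nu> A = prob A'" "A \<succeq> A'" "A' \<succeq> A"
    using matching_event_exists[OF assms(1)] .
  obtain B' where B': "B' \<in> sets P" "\<nu> B = prob B'" "B \<succeq> B'" "B' \<succeq> B"
    using matching_event_exists[OF assms(2)] .
  have "A \<succeq> B \<longleftrightarrow> A' \<succeq> B'" using A' B' event_pref_trans by meson
  then show ?thesis using A' B' event_pref_iff_prob by simp
qed

text \<open>An event of \<G> and its match both lie in \<G>, and indifference there forces equal
  probabilities.\<close>

lemma matching_risk_conforming: "risk_conforming P \<nu>"
  unfolding risk_conforming_def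
proof
  fix A assume A: "A \<in> sets P"
  then obtain B where "B \<in> sets P" "\<nu> A = prob B" "A \<succeq> B" "B \<succeq> A"
    using matching_event_exists sets_P_F by blast
  then show "\<nu> A = prob A" using A event_pref_iff_prob by (simp add: order_antisym)
qed

lemma matching_bounds: "A \<in> sets F \<Longrightarrow> 0 \<le> \<nu> A \<and> \<nu> A \<le> 1"
  using \<nu> unfolding matching_probability_def by (auto dest: PiE_mem)

lemma matching_mono: "A \<in> sets F \<Longrightarrow> B \<in> sets F \<Longrightarrow> A \<subseteq> B \<Longrightarrow> \<nu> A \<le> \<nu> B"
  using event_pref_iff_matching event_pref_mono by blast

text \<open>This turns a limit of values of \<open>\<nu>\<close> into an event, which (C) can
  compare with the limit of the events.\<close>

lemma event_with_matching_value:
  assumes "0 \<le> t" "t \<le> 1"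
  obtains B where "B \<in> sets F" "\<nu> B = t"
proof -
  obtain B where "B \<in> sets P" "prob B = t"
    using atomless_subset[OF atomless sets.top assms(1)] assms(2) prob_space by metis
  then show thesis
    using that matching_risk_conforming sets_P_F unfolding risk_conforming_def by blast
qed

lemma matching_capacity: "capacity F \<nu>"
proof -
  have "\<nu> {} = 0" "\<nu> (space F) = 1"
    using matching_risk_conforming prob_space sets.top[of P] unfolding risk_conforming_def by auto
  moreover have "\<nu> \<in> extensional (sets F)"
    using \<nu> unfolding matching_probability_def by (auto simp: PiE_def)
  ultimately show ?thesis unfolding capacity_def using matching_mono by blast
qed

lemma matching_incseq:
  assumes A: "range A \<subseteq> sets F" "incseq A"
  shows "(\<lambda>n::nat. \<nu> (A n)) \<longlonglongrightarrow> \<nu> (\<Union>n. A n)"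
proof -
  have AF: "A n \<in> sets F" "(\<Union>n. A n) \<in> sets F" for n using A(1) by auto
  have "incseq (\<lambda>n. \<nu> (A n))" using A(2) AF matching_mono by (simp add: incseq_def)
  then obtain l where l: "(\<lambda>n. \<nu> (A n)) \<longlonglongrightarrow> l" "\<And>n. \<nu> (A n) \<le> l"
    using incseq_convergent[of "\<lambda>n. \<nu> (A n)" 1] matching_bounds AF by blast
  have l_le: "l \<le> \<nu> (\<Union>n. A n)"
    using l(1) matching_mono AF by (intro LIMSEQ_le_const2) blast+
  obtain B where B: "B \<in> sets F" "\<nu> B = l"
    using event_with_matching_value[of l] l_le l(2)[of 0] matching_bounds AF by (meson order_trans)
  \<comment> \<open>\<open>B\<close> is preferred to every \<open>A n\<close>, and (C) carries this
    to the union, so \<open>\<nu>\<close> of the union cannot exceed \<open>l\<close>.\<close>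
  have "B \<succeq> (\<Union>n. A n)"
    using A B l(2) AF event_pref_iff_matching by (intro event_pref_incseq) auto
  then have "\<nu> (\<Union>n. A n) = l" using l_le B AF event_pref_iff_matching by simp
  then show ?thesis using l(1) by simp
qed

lemma matching_decseq:
  assumes A: "range A \<subseteq> sets F" "decseq A"
  shows "(\<lambda>n::nat. \<nu> (A n)) \<longlonglongrightarrow> \<nu> (\<Inter>n. A n)"
proof -
  have AF: "A n \<in> sets F" "(\<Inter>n. A n) \<in> sets F" for n using A(1) by auto
  have "decseq (\<lambda>n. \<nu> (A n))" using A(2) AF matching_mono by (simp add: decseq_def)
  then obtain l where l: "(\<lambda>n. \<nu> (A n)) \<longlonglongrightarrow> l" "\<And>n. l \<le> \<nu> (A n)"
    using decseq_convergent[of "\<lambda>n. \<nu> (A n)" 0] matching_bounds AF by blast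
  have le_l: "\<nu> (\<Inter>n. A n) \<le> l"
    using l(1) matching_mono AF by (intro LIMSEQ_le_const) blast+
  obtain B where B: "B \<in> sets F" "\<nu> B = l"
    using event_with_matching_value[of l] le_l l(2)[of 0] matching_bounds AF by (meson order_trans)
  \<comment> \<open>Dually, every \<open>A n\<close> is preferred to \<open>B\<close>, hence so is
    the intersection, whose value is thus at least \<open>l\<close>.\<close>
  have "(\<Inter>n. A n) \<succeq> B"
    using A B l(2) AF event_pref_iff_matching by (intro event_pref_decseq) auto
  then have "\<nu> (\<Inter>n. A n) = l" using le_l B AF event_pref_iff_matching by simp
  then show ?thesis using l(1) by simp
qed

end

end

theorem proposition2:
  fixes F P :: "'a measure" and R :: "('a \<Rightarrow> real) rel"
  assumes "subalgebra F P" and "prob_space P" and "atomless P"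
    and "preference_relation F R"
    and "axiom_RC P R" and "axiom_M F R" and "axiom_SRM P R" and "axiom_C F R"
  shows "(\<exists>!\<nu>. matching_probability F P R \<nu>) \<and>
    (\<forall>\<nu>. matching_probability F P R \<nu> \<longrightarrow>
      continuous_capacity F \<nu> \<and> risk_conforming P \<nu> \<and>
      (\<forall>A\<in>sets F. \<forall>B\<in>sets F. event_preferred F R A B \<longleftrightarrow> \<nu> A \<ge> \<nu> B))"
proof -
  interpret regular_preference P F R
    using assms by (simp add: regular_preference_def regular_preference_axioms_def)
  show ?thesis
    using matching_probability_ex1 matching_capacity matching_incseq matching_decseq
      matching_risk_conforming event_pref_iff_matching
    unfolding continuous_capacity_def by blast
qed

end
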